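(* Let $G=\langle S \mid \mathcal{R} \rangle$ be a countably generated recursively enumerable presentation of a just infinite group which is not locally finite. Then there exists an algorithm (which may depend on the presentation) that, given a word $x$ in the generators $S$, decides whether the equality $x=1$ holds in $G$.
   Context: A group $G$ is just infinite if it is infinite and for every non-trivial normal subgroup $H\triangleleft G$ the quotient $G/H$ is finite. A group is locally finite if all its finitely generated subgroups are finite. A countably generated recursively enumerable presentation $\langle S\mid\mathcal R\rangle$ of a group $G$ consists of a countably infinite alphabet of generators $S=\{a_1,a_2,\ldots\}$ (formal letters indexed by the positive integers; different letters may represent equal elements of $G$, possibly trivial) and an algorithm $\mathcal R$ enumerating a set of words in $S\cup S^{-1}$, the defining relations, such that $G$ is the quotient of the free group on $S$ by the normal closure of this set. Words in $S\cup S^{-1}$ are encoded as finite words in a finite alphabet in the evident effective way. *)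

theory Defs
  imports "HOL-Algebra.Generated_Groups" "HOL-Library.Nat_Bijection"
begin

section \<open>Partial recursive functions\<close>

text \<open>
  An algorithm is a term denoting a partial recursive function (Kleene). Terms carry no arity
  annotation: \<open>computes p xs y\<close> says that \<open>p\<close> halts on the argument list \<open>xs\<close>
  with output \<open>y\<close>.
\<close>

datatype recfn =
    Zero
  | Succ
  | Proj nat
  | Comp recfn "recfn list"
  | PrimRec recfn recfn
  | Minimize recfn

inductive computes :: "recfn \<Rightarrow> nat list \<Rightarrow> nat \<Rightarrow> bool" where
  zero: "computes Zero xs 0"
| succ: "computes Succ [x] (Suc x)"
| proj: "i < length xs \<Longrightarrow> computes (Proj i) xs (xs ! i)"
| comp: "list_all2 (\<lambda>g y. computes g xs y) gs ys \<Longrightarrow> computes f ys z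
    \<Longrightarrow> computes (Comp f gs) xs z"
| primrec_0: "computes f xs y \<Longrightarrow> computes (PrimRec f g) (0 # xs) y"
| primrec_Suc: "computes (PrimRec f g) (n # xs) r \<Longrightarrow> computes g (n # r # xs) y
    \<Longrightarrow> computes (PrimRec f g) (Suc n # xs) y"
| minimize: "computes f (n # xs) 0 \<Longrightarrow> (\<And>m. m < n \<Longrightarrow> \<exists>y. computes f (m # xs) (Suc y))
    \<Longrightarrow> computes (Minimize f) xs n"

inductive_cases computes_ZeroE: "computes Zero xs y"
inductive_cases computes_SuccE: "computes Succ xs y"
inductive_cases computes_ProjE: "computes (Proj i) xs y"
inductive_cases computes_CompE: "computes (Comp f gs) xs y"
inductive_cases computes_PrimRec_0E: "computes (PrimRec f g) (0 # xs) y"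
inductive_cases computes_PrimRec_SucE: "computes (PrimRec f g) (Suc n # xs) y"
inductive_cases computes_MinimizeE: "computes (Minimize f) xs y"

lemma computes_deterministic: "computes p xs y \<Longrightarrow> computes p xs z \<Longrightarrow> y = z"
proof (induction arbitrary: z rule: computes.induct)
  case zero
  then show ?case by (rule computes_ZeroE) simp
next
  case succ
  then show ?case by (rule computes_SuccE) simp
next
  case proj
  from proj.prems show ?case by (rule computes_ProjE) simp
next
  case (comp xs gs ys f z')
  from comp.prems obtain ys' where
    ys': "list_all2 (\<lambda>g y. computes g xs y) gs ys'" "computes f ys' z"
    by (rule computes_CompE)
  have "ys = ys'"
    using comp.IH(1) ys'(1) by (auto simp: list_all2_conv_all_nth intro!: nth_equalityI)
  with comp.IH(2) ys'(2) show ?case by blast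
next
  case (primrec_0 f xs y g)
  from primrec_0.prems have "computes f xs z" by (rule computes_PrimRec_0E)
  then show ?case by (rule primrec_0.IH)
next
  case (primrec_Suc f g n xs r y)
  from primrec_Suc.prems obtain r' where
    "computes (PrimRec f g) (n # xs) r'" "computes g (n # r' # xs) z"
    by (rule computes_PrimRec_SucE)
  with primrec_Suc.IH show ?case by blast
next
  case (minimize f n xs)
  from minimize.prems have z: "computes f (z # xs) 0"
    "\<And>m. m < z \<Longrightarrow> \<exists>y. computes f (m # xs) (Suc y)"
    by (rule computes_MinimizeE, blast)+
  show ?case
  proof (rule linorder_cases)
    assume "n < z"
    from z(2)[OF this] minimize.IH(1) show ?thesis by blast
  next
    assume "z < n"
    from minimize.IH(2)[OF this] z(1) show ?thesis by blast
  qed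
qed

definition recursive_function :: "(nat \<Rightarrow> nat) \<Rightarrow> bool" where
  "recursive_function f \<longleftrightarrow> (\<exists>p. \<forall>n. computes p [n] (f n))"

definition recursively_enumerable :: "nat set \<Rightarrow> bool" where
  "recursively_enumerable A \<longleftrightarrow> A = {} \<or> (\<exists>f. recursive_function f \<and> A = range f)"

definition decidable :: "nat set \<Rightarrow> bool" where
  "decidable A \<longleftrightarrow> recursive_function (\<lambda>n. if n \<in> A then 1 else 0)"


section \<open>Free groups and presentations\<close>

text \<open>
  The letter \<open>Inl s\<close> stands for the generator \<open>s\<close> and \<open>Inr s\<close> for its formal
  inverse. The free group is realised on the freely reduced words.
\<close>

type_synonym 'a gword = "('a + 'a) list"

fun letter_inv :: "'a + 'a \<Rightarrow> 'a + 'a" where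
  "letter_inv (Inl s) = Inr s"
| "letter_inv (Inr s) = Inl s"

fun reduced_cons :: "'a + 'a \<Rightarrow> 'a gword \<Rightarrow> 'a gword" where
  "reduced_cons x [] = [x]"
| "reduced_cons x (y # ys) = (if y = letter_inv x then ys else x # y # ys)"

definition free_reduce :: "'a gword \<Rightarrow> 'a gword" where
  "free_reduce w = foldr reduced_cons w []"

definition free_group :: "'a gword monoid" where
  "free_group = \<lparr>carrier = {w. successively (\<lambda>x y. y \<noteq> letter_inv x) w},
    mult = (\<lambda>u v. free_reduce (u @ v)), one = []\<rparr>"

definition normal_closure :: "('g, 'm) monoid_scheme \<Rightarrow> 'g set \<Rightarrow> 'g set" where
  "normal_closure G A = \<Inter> {N. N \<lhd> G \<and> A \<subseteq> N}"

definition relator_subgroup :: "'a gword set \<Rightarrow> 'a gword set" where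
  "relator_subgroup R = normal_closure free_group (free_reduce ` R)"

definition presented_group :: "'a gword set \<Rightarrow> 'a gword set monoid" where
  "presented_group R = free_group Mod relator_subgroup R"

text \<open>The element of the presented group represented by a word.\<close>

definition word_value :: "'a gword set \<Rightarrow> 'a gword \<Rightarrow> 'a gword set" where
  "word_value R w = relator_subgroup R #>\<^bsub>free_group\<^esub> free_reduce w"

lemma letter_inv_inv [simp]: "letter_inv (letter_inv x) = x"
  by (cases x) auto

lemma letter_inv_neq [simp]: "letter_inv x \<noteq> x" "x \<noteq> letter_inv x"
  by (cases x; simp)+

lemma reduced_cons_closed:
  "w \<in> carrier free_group \<Longrightarrow> reduced_cons x w \<in> carrier free_group"
  by (cases w; cases "tl w") (auto simp: free_group_def successively_Cons)

lemma free_reduce_closed: "free_reduce w \<in> carrier free_group"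
proof (induction w)
  case Nil
  show ?case by (simp add: free_reduce_def free_group_def)
next
  case (Cons x w)
  then show ?case using reduced_cons_closed by (simp add: free_reduce_def)
qed

lemma free_reduce_id: "w \<in> carrier free_group \<Longrightarrow> free_reduce w = w"
proof (induction w)
  case Nil
  show ?case by (simp add: free_reduce_def)
next
  case (Cons x w)
  then have "w \<in> carrier free_group" "w = [] \<or> hd w \<noteq> letter_inv x"
    by (auto simp: free_group_def successively_Cons)
  with Cons.IH show ?case by (cases w) (simp_all add: free_reduce_def)
qed

lemma reduced_cons_cancel:
  assumes "w \<in> carrier free_group"
  shows "reduced_cons x (reduced_cons (letter_inv x) w) = w"
  using assms by (cases w; cases "tl w") (auto simp: free_group_def successively_Cons)

lemma free_reduce_append: "free_reduce (u @ v) = foldr reduced_cons u (free_reduce v)"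
  by (simp add: free_reduce_def)

lemma free_reduce_append_right: "free_reduce (u @ free_reduce v) = free_reduce (u @ v)"
  by (simp add: free_reduce_append free_reduce_id free_reduce_closed)

lemma free_reduce_append_left: "free_reduce (free_reduce u @ v) = free_reduce (u @ v)"
proof (induction u)
  case Nil
  show ?case by (simp add: free_reduce_def)
next
  case (Cons x u)
  have 1: "free_reduce (reduced_cons x w @ v) = reduced_cons x (free_reduce (w @ v))" for w
  proof (cases w)
    case (Cons y w')
    then show ?thesis
      using reduced_cons_cancel[OF free_reduce_closed, of x "w' @ v"]
      by (auto simp: free_reduce_def)
  qed (simp add: free_reduce_def)
  have "free_reduce (x # u) = reduced_cons x (free_reduce u)"
    by (simp add: free_reduce_def)
  with 1 Cons.IH show ?case by (simp add: free_reduce_def)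
qed

definition word_inv :: "'a gword \<Rightarrow> 'a gword" where
  "word_inv w = rev (map letter_inv w)"

lemma free_reduce_word_inv: "free_reduce (word_inv w @ w) = []"
proof (induction w)
  case (Cons x w)
  have "reduced_cons (letter_inv x) (reduced_cons x (free_reduce w)) = free_reduce w"
    using reduced_cons_cancel[OF free_reduce_closed, of "letter_inv x" w] by simp
  then have "free_reduce (word_inv (x # w) @ x # w) = free_reduce (word_inv w @ w)"
    by (simp add: word_inv_def free_reduce_def)
  with Cons.IH show ?case by simp
qed (simp add: word_inv_def free_reduce_def)

lemma group_free_group: "group free_group"
proof (rule groupI)
  fix u v w :: "'a gword"
  assume "u \<in> carrier free_group"
  show "u \<otimes>\<^bsub>free_group\<^esub> v \<in> carrier free_group"
    using free_reduce_closed[of "u @ v"] by (simp add: free_group_def)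
  show "u \<otimes>\<^bsub>free_group\<^esub> v \<otimes>\<^bsub>free_group\<^esub> w = u \<otimes>\<^bsub>free_group\<^esub> (v \<otimes>\<^bsub>free_group\<^esub> w)"
    by (simp add: free_group_def free_reduce_append_left free_reduce_append_right)
  show "\<one>\<^bsub>free_group\<^esub> \<otimes>\<^bsub>free_group\<^esub> u = u"
    using free_reduce_id[OF \<open>u \<in> carrier free_group\<close>] by (simp add: free_group_def)
  show "\<exists>y\<in>carrier free_group. y \<otimes>\<^bsub>free_group\<^esub> u = \<one>\<^bsub>free_group\<^esub>"
    using free_reduce_closed[of "word_inv u"] free_reduce_word_inv[of u]
    by (intro bexI[of _ "free_reduce (word_inv u)"])
      (simp_all add: free_group_def free_reduce_append_left)
qed (simp add: free_group_def)

lemma relator_subgroup_normal: "relator_subgroup R \<lhd> free_group"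
proof -
  interpret F: group "free_group :: 'a gword monoid" by (rule group_free_group)
  let ?S = "{N. N \<lhd> free_group \<and> free_reduce ` R \<subseteq> N}"
  have ne: "carrier free_group \<in> ?S"
    using F.normal_self free_reduce_closed by auto
  have "subgroup (\<Inter> ?S) free_group"
    by (rule F.subgroups_Inter) (use ne in \<open>auto intro: normal_imp_subgroup\<close>)
  moreover have "x \<otimes>\<^bsub>free_group\<^esub> h \<otimes>\<^bsub>free_group\<^esub> inv\<^bsub>free_group\<^esub> x \<in> \<Inter> ?S"
    if "x \<in> carrier free_group" "h \<in> \<Inter> ?S" for x h
    using that by (auto simp: F.normal_inv_iff)
  ultimately show ?thesis
    unfolding relator_subgroup_def normal_closure_def by (simp only: F.normal_inv_iff) blast
qed

lemma group_presented_group: "group (presented_group R)"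
  unfolding presented_group_def by (rule normal.factorgroup_is_group[OF relator_subgroup_normal])


section \<open>Just infinite groups, locally finite groups\<close>

definition just_infinite :: "('g, 'm) monoid_scheme \<Rightarrow> bool" where
  "just_infinite G \<longleftrightarrow> group G \<and> infinite (carrier G) \<and>
    (\<forall>N. N \<lhd> G \<and> N \<noteq> {\<one>\<^bsub>G\<^esub>} \<longrightarrow> finite (carrier (G Mod N)))"

definition locally_finite :: "('g, 'm) monoid_scheme \<Rightarrow> bool" where
  "locally_finite G \<longleftrightarrow> group G \<and>
    (\<forall>A. finite A \<and> A \<subseteq> carrier G \<longrightarrow> finite (generate G A))"


section \<open>Coding words over a countably infinite alphabet\<close>

text \<open>
  The generator $a_{i+1}$ is the letter \<open>Inl i\<close>. Both \<open>sum_encode\<close> and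
  \<open>list_encode\<close> are bijections onto the naturals, so every number codes exactly one word.
\<close>

definition word_code :: "nat gword \<Rightarrow> nat" where
  "word_code w = list_encode (map sum_encode w)"

end

theory Submission
  imports Defs
begin

text \<open>
  Since the group is not locally finite, for some \<open>m\<close> the subgroup \<open>H\<close> generated by
  the first \<open>m\<close> generators is infinite. Add a word \<open>x\<close> to the relators. If
  \<open>x\<close> is trivial, nothing changes and the image of \<open>H\<close> stays infinite; if not, the
  whole quotient is finite because the group is just infinite. So \<open>x\<close> is non-trivial iff there
  is a positive \<open>N\<close> such that, modulo the extended relators, the finite set of words with code
  below \<open>N\<close> is closed under left multiplication by the first \<open>m\<close> generators and their
  inverses. A finite certificate, made of explicit products of conjugates of relators, witnesses this
  closure, and likewise the triviality of \<open>x\<close>; searching for either kind of certificate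
  decides which one holds.
\<close>

section \<open>Closure properties of recursive functions\<close>

lemma computes_Proj: "i < length xs \<Longrightarrow> xs ! i = y \<Longrightarrow> computes (Proj i) xs y"
  using proj by blast

lemma computes_Comp1:
  "computes g xs y \<Longrightarrow> computes f [y] z \<Longrightarrow> computes (Comp f [g]) xs z"
  by (rule comp[where ys = "[y]"]) auto

lemma computes_Comp2:
  "computes g xs y \<Longrightarrow> computes h xs y' \<Longrightarrow> computes f [y, y'] z \<Longrightarrow> computes (Comp f [g, h]) xs z"
  by (rule comp[where ys = "[y, y']"]) auto

lemma computes_PrimRec:
  assumes "computes f xs b" "\<And>i r. computes g (i # r # xs) (s i r)"
  shows "computes (PrimRec f g) (n # xs) (rec_nat b s n)"
proof (induction n)
  case 0
  show ?case using assms(1) by (auto intro: primrec_0)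
next
  case (Suc n)
  show ?case using primrec_Suc[OF Suc assms(2)] by simp
qed

lemma recursive_const: "recursive_function (\<lambda>x. c)"
proof (induction c)
  case 0
  show ?case unfolding recursive_function_def using zero by blast
next
  case (Suc c)
  then obtain p where "computes p [n] c" for n unfolding recursive_function_def by blast
  then have "computes (Comp Succ [p]) [n] (Suc c)" for n by (blast intro: computes_Comp1 succ)
  then show ?case unfolding recursive_function_def by blast
qed

lemma recursive_id: "recursive_function (\<lambda>x. x)"
  unfolding recursive_function_def by (rule exI[of _ "Proj 0"]) (simp add: computes_Proj)

lemma recursive_compose:
  assumes "recursive_function f" "recursive_function g"
  shows "recursive_function (\<lambda>x. f (g x))"
proof -
  obtain p q where "\<And>n. computes p [n] (f n)" "\<And>n. computes q [n] (g n)"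
    using assms unfolding recursive_function_def by blast
  then have "computes (Comp p [q]) [n] (f (g n))" for n by (blast intro: computes_Comp1)
  then show ?thesis unfolding recursive_function_def by blast
qed

lemma recursive_Suc: "recursive_function f \<Longrightarrow> recursive_function (\<lambda>x. Suc (f x))"
  by (rule recursive_compose[of Suc]) (auto simp: recursive_function_def intro!: exI[of _ Succ] succ)

text \<open>\<open>recursive_function\<close> speaks of one argument only. Two-argument programs are
  needed for arithmetic, for pairing itself, and for \<open>PrimRec\<close> and
  \<open>Minimize\<close>, which put their own variable in front of the parameter.\<close>

definition binary_recursive :: "(nat \<Rightarrow> nat \<Rightarrow> nat) \<Rightarrow> bool" where
  "binary_recursive f \<longleftrightarrow> (\<exists>p. \<forall>m n. computes p [m, n] (f m n))"

lemma binary_recursive_compose: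
  assumes "binary_recursive f" "recursive_function g" "recursive_function h"
  shows "recursive_function (\<lambda>x. f (g x) (h x))"
proof -
  obtain p q r where "\<And>m n. computes p [m, n] (f m n)" "\<And>n. computes q [n] (g n)"
    "\<And>n. computes r [n] (h n)"
    using assms unfolding recursive_function_def binary_recursive_def by blast
  then have "computes (Comp p [q, r]) [n] (f (g n) (h n))" for n by (blast intro: computes_Comp2)
  then show ?thesis unfolding recursive_function_def by blast
qed

lemma binary_recursive_compose2:
  assumes "binary_recursive f" "binary_recursive g" "binary_recursive h"
  shows "binary_recursive (\<lambda>x y. f (g x y) (h x y))"
proof -
  obtain p q r where "\<And>m n. computes p [m, n] (f m n)" "\<And>m n. computes q [m, n] (g m n)"
    "\<And>m n. computes r [m, n] (h m n)"
    using assms unfolding binary_recursive_def by blast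
  then have "computes (Comp p [q, r]) [m, n] (f (g m n) (h m n))" for m n
    by (blast intro: computes_Comp2)
  then show ?thesis unfolding binary_recursive_def by blast
qed

lemma recursive_binary_compose:
  assumes "recursive_function f" "binary_recursive g"
  shows "binary_recursive (\<lambda>x y. f (g x y))"
proof -
  obtain p q where "\<And>n. computes p [n] (f n)" "\<And>m n. computes q [m, n] (g m n)"
    using assms unfolding recursive_function_def binary_recursive_def by blast
  then have "computes (Comp p [q]) [m, n] (f (g m n))" for m n
    by (blast intro: computes_Comp1)
  then show ?thesis unfolding binary_recursive_def by blast
qed

lemma binary_recursive_fst: "binary_recursive (\<lambda>m n. m)"
  unfolding binary_recursive_def by (rule exI[of _ "Proj 0"]) (simp add: computes_Proj)

lemma binary_recursive_snd: "binary_recursive (\<lambda>m n. n)"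
  unfolding binary_recursive_def by (rule exI[of _ "Proj 1"]) (simp add: computes_Proj)

section \<open>Arithmetic and the pairing function\<close>

lemma binary_recursive_add: "binary_recursive (+)"
proof -
  have "computes (PrimRec (Proj 0) (Comp Succ [Proj 1])) [m, n] (rec_nat n (\<lambda>i r. Suc r) m)" for m n
    by (intro computes_PrimRec computes_Comp1[OF _ succ] computes_Proj) auto
  moreover have "rec_nat n (\<lambda>i r. Suc r) m = m + n" for m n :: nat
    by (induction m) auto
  ultimately show ?thesis unfolding binary_recursive_def by (auto intro!: exI)
qed

lemma recursive_pred: "recursive_function (\<lambda>n. n - 1)"
proof -
  have "computes (PrimRec Zero (Proj 0)) [n] (rec_nat 0 (\<lambda>i r. i) n)" for n
    by (intro computes_PrimRec computes_Proj zero) auto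
  moreover have "rec_nat 0 (\<lambda>i r. i) n = n - 1" for n :: nat
    by (cases n) auto
  ultimately show ?thesis unfolding recursive_function_def by (auto intro!: exI)
qed

lemma binary_recursive_diff: "binary_recursive (-)"
proof -
  obtain p where p: "\<And>n. computes p [n] (n - 1)"
    using recursive_pred unfolding recursive_function_def by blast
  \<comment> \<open>\<open>PrimRec\<close> recurses on the first argument, so iterating the
    predecessor subtracts \<open>m\<close> from \<open>n\<close>, the arguments in the wrong order;
    composition with projections swaps them at the end.\<close>
  have "computes (PrimRec (Proj 0) (Comp p [Proj 1])) [m, n] (rec_nat n (\<lambda>i r. r - 1) m)" for m n
    by (intro computes_PrimRec computes_Comp1[OF _ p] computes_Proj) auto
  moreover have "rec_nat n (\<lambda>i r. r - 1) m = n - m" for m n :: nat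
    by (induction m) auto
  ultimately have "binary_recursive (\<lambda>m n. n - m)"
    unfolding binary_recursive_def by (auto intro!: exI)
  from binary_recursive_compose2[OF this binary_recursive_snd binary_recursive_fst]
  show ?thesis .
qed

lemma recursive_triangle: "recursive_function triangle"
proof -
  obtain p where p: "\<And>m n. computes p [m, n] (m + n)"
    using binary_recursive_add unfolding binary_recursive_def by blast
  have "computes (PrimRec Zero (Comp p [Comp Succ [Proj 0], Proj 1])) [n]
    (rec_nat 0 (\<lambda>i r. Suc i + r) n)" for n
    by (intro computes_PrimRec computes_Comp1[OF _ succ] computes_Comp2[OF _ _ p] computes_Proj zero)
      auto
  moreover have "rec_nat 0 (\<lambda>i r. Suc i + r) n = triangle n" for n :: nat
    by (induction n) auto
  ultimately show ?thesis unfolding recursive_function_def by (auto intro!: exI)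
qed

lemma binary_recursive_prod_encode: "binary_recursive (\<lambda>m n. prod_encode (m, n))"
  unfolding prod_encode_def prod.case
  by (intro binary_recursive_compose2[OF binary_recursive_add] binary_recursive_fst
      recursive_binary_compose[OF recursive_triangle] binary_recursive_add)

lemma recursive_prod_encode:
  "recursive_function f \<Longrightarrow> recursive_function g \<Longrightarrow> recursive_function (\<lambda>x. prod_encode (f x, g x))"
  by (rule binary_recursive_compose[OF binary_recursive_prod_encode])

lemma recursive_add:
  "recursive_function f \<Longrightarrow> recursive_function g \<Longrightarrow> recursive_function (\<lambda>x. f x + g x)"
  by (rule binary_recursive_compose[OF binary_recursive_add])

lemma recursive_diff:
  "recursive_function f \<Longrightarrow> recursive_function g \<Longrightarrow> recursive_function (\<lambda>x. f x - g x)"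
  by (rule binary_recursive_compose[OF binary_recursive_diff])

section \<open>Minimization and the inverse of the pairing function\<close>

lemma recursive_minimize:
  assumes "binary_recursive f" "\<And>x. \<exists>n. f n x = 0"
  shows "recursive_function (\<lambda>x. LEAST n. f n x = 0)"
proof -
  obtain p where p: "\<And>m n. computes p [m, n] (f m n)"
    using assms(1) unfolding binary_recursive_def by blast
  have "computes (Minimize p) [x] (LEAST n. f n x = 0)" for x
  proof (rule minimize)
    show "computes p [LEAST n. f n x = 0, x] 0"
      using p[of "LEAST n. f n x = 0" x] LeastI_ex[OF assms(2)[of x]] by simp
  next
    fix m assume "m < (LEAST n. f n x = 0)"
    then have "f m x \<noteq> 0" by (rule not_less_Least)
    then show "\<exists>y. computes p [m, x] (Suc y)" using p[of m x] by (metis not0_implies_Suc)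
  qed
  then show ?thesis unfolding recursive_function_def by blast
qed

text \<open>Since \<open>prod_encode (m, n) = triangle (m + n) + m\<close>, the pairs with sum
  \<open>k\<close> have the codes from \<open>triangle k\<close> up to, but not including, an upper
  end at most \<open>triangle (Suc k)\<close>. The sum is thus the least \<open>k\<close> whose next
  triangle number exceeds the code; truncated subtraction puts this as the vanishing of a term, as
  minimization requires.\<close>

definition diagonal_index :: "nat \<Rightarrow> nat" where
  "diagonal_index n = (LEAST k. Suc n - triangle (Suc k) = 0)"

lemma diagonal_index_prod_encode: "diagonal_index (prod_encode (m, n)) = m + n"
  unfolding diagonal_index_def
proof (rule Least_equality)
  show "Suc (prod_encode (m, n)) - triangle (Suc (m + n)) = 0"
    by (simp add: prod_encode_def)
next
  fix k assume k: "Suc (prod_encode (m, n)) - triangle (Suc k) = 0"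
  have mono: "triangle i \<le> triangle j" if "i \<le> j" for i j
    using that by (induction rule: dec_induct) auto
  show "m + n \<le> k"
  proof (rule ccontr)
    assume "\<not> m + n \<le> k"
    then have "triangle (Suc k) \<le> triangle (m + n)" by (intro mono) simp
    with k show False by (simp add: prod_encode_def)
  qed
qed

lemma recursive_diagonal_index: "recursive_function diagonal_index"
  unfolding diagonal_index_def
proof (rule recursive_minimize)
  show "binary_recursive (\<lambda>k n. Suc n - triangle (Suc k))"
    by (intro binary_recursive_compose2[OF binary_recursive_diff]
        recursive_binary_compose[OF recursive_triangle] recursive_binary_compose[where f = Suc]
        recursive_Suc[OF recursive_id] binary_recursive_fst binary_recursive_snd)
next
  fix n :: nat
  have "Suc n \<le> triangle (Suc n)" by simp
  then show "\<exists>k. Suc n - triangle (Suc k) = 0" by (metis diff_is_0_eq)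
qed

text \<open>Both projections become terms in subtraction, \<open>triangle\<close> and
  \<open>diagonal_index\<close>, all known to be recursive, so the recursion defining
  \<open>prod_decode\<close> need not be simulated.\<close>

lemma prod_decode_diagonal_index:
  "fst (prod_decode n) = n - triangle (diagonal_index n)"
  "snd (prod_decode n) = diagonal_index n - (n - triangle (diagonal_index n))"
proof -
  obtain a b where n: "n = prod_encode (a, b)" by (metis prod_decode_inverse surj_pair)
  then have "n - triangle (diagonal_index n) = a"
    unfolding n diagonal_index_prod_encode by (simp add: prod_encode_def)
  then show "fst (prod_decode n) = n - triangle (diagonal_index n)"
    "snd (prod_decode n) = diagonal_index n - (n - triangle (diagonal_index n))"
    using n by (simp_all add: diagonal_index_prod_encode)
qed

lemma recursive_fst_prod_decode:
  assumes "recursive_function f"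
  shows "recursive_function (\<lambda>x. fst (prod_decode (f x)))"
  unfolding prod_decode_diagonal_index
  by (intro recursive_diff recursive_compose[OF recursive_triangle]
      recursive_compose[OF recursive_diagonal_index] assms)

lemma recursive_snd_prod_decode:
  assumes "recursive_function f"
  shows "recursive_function (\<lambda>x. snd (prod_decode (f x)))"
  unfolding prod_decode_diagonal_index
  by (intro recursive_diff recursive_compose[OF recursive_triangle]
      recursive_compose[OF recursive_diagonal_index] assms)

text \<open>The ternary step is taken on one packed argument \<open>(i, (r, c))\<close>. Its premise
  is therefore again a \<open>recursive_function\<close> goal, and nested recursions can be handled
  by the same rules.\<close>

lemma recursive_rec_nat:
  assumes "recursive_function n" "recursive_function b"
    and s: "recursive_function (\<lambda>z. s (fst (prod_decode z)) (fst (prod_decode (snd (prod_decode z))))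
      (snd (prod_decode (snd (prod_decode z)))))"
  shows "recursive_function (\<lambda>c. rec_nat (b c) (\<lambda>i r. s i r c) (n c))"
proof -
  obtain p q e where p: "\<And>n. computes p [n] (b n)"
    and q: "\<And>z. computes q [z] (s (fst (prod_decode z)) (fst (prod_decode (snd (prod_decode z))))
      (snd (prod_decode (snd (prod_decode z)))))"
    and e: "\<And>m n. computes e [m, n] (prod_encode (m, n))"
    using assms binary_recursive_prod_encode
    unfolding recursive_function_def binary_recursive_def by blast
  have "computes (Comp q [Comp e [Proj 0, Comp e [Proj 1, Proj 2]]]) [i, r, c] (s i r c)" for i r c
  proof (rule computes_Comp1)
    show "computes (Comp e [Proj 0, Comp e [Proj 1, Proj 2]]) [i, r, c]
        (prod_encode (i, prod_encode (r, c)))"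
      by (intro computes_Comp2[OF _ _ e] computes_Proj) auto
    show "computes q [prod_encode (i, prod_encode (r, c))] (s i r c)"
      using q[of "prod_encode (i, prod_encode (r, c))"] by simp
  qed
  then have "computes (PrimRec p (Comp q [Comp e [Proj 0, Comp e [Proj 1, Proj 2]]])) [k, c]
      (rec_nat (b c) (\<lambda>i r. s i r c) k)" for k c
    by (intro computes_PrimRec p)
  then have "binary_recursive (\<lambda>k c. rec_nat (b c) (\<lambda>i r. s i r c) k)"
    unfolding binary_recursive_def by blast
  then show ?thesis by (rule binary_recursive_compose[OF _ assms(1) recursive_id])
qed

section \<open>Rules that derive recursiveness and decidability along the structure of a
  term\<close>

named_theorems recursive_intros

lemmas [recursive_intros] = recursive_const recursive_id recursive_Suc recursive_add recursive_diff
  recursive_prod_encode recursive_fst_prod_decode recursive_snd_prod_decode recursive_rec_nat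

lemma decidable_compose: "decidable {x. P x} \<Longrightarrow> recursive_function f \<Longrightarrow> decidable {x. P (f x)}"
  unfolding decidable_def mem_Collect_eq by (rule recursive_compose)

text \<open>A case distinction is a primitive recursion whose length is the indicator of
  \<open>P\<close>: zero steps leave \<open>g x\<close>, one step overwrites it by
  \<open>f x\<close>.\<close>

lemma recursive_if [recursive_intros]:
  assumes "decidable {x. P x}" "recursive_function f" "recursive_function g"
  shows "recursive_function (\<lambda>x. if P x then f x else g x)"
proof -
  have "recursive_function (\<lambda>x. rec_nat (g x) (\<lambda>i r. f x) (if P x then 1 else 0))"
    using assms(1) unfolding decidable_def mem_Collect_eq
    by (intro recursive_intros assms(3) recursive_compose[OF assms(2)])
  moreover have "(\<lambda>x. rec_nat (g x) (\<lambda>i r. f x) (if P x then 1 else 0))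
      = (\<lambda>x. if P x then f x else g x)"
    by auto
  ultimately show ?thesis by simp
qed

lemma decidable_eq [recursive_intros]:
  assumes "recursive_function f" "recursive_function g"
  shows "decidable {x. f x = g x}"
proof -
  have "recursive_function (\<lambda>x. 1 - ((f x - g x) + (g x - f x)))"
    by (intro recursive_intros assms)
  moreover have "(\<lambda>x. 1 - ((f x - g x) + (g x - f x))) = (\<lambda>x. if f x = g x then 1 else 0)"
    by auto
  ultimately show ?thesis by (simp add: decidable_def)
qed

lemma decidable_less [recursive_intros]:
  assumes "recursive_function f" "recursive_function g"
  shows "decidable {x. f x < g x}"
proof -
  have "recursive_function (\<lambda>x. 1 - (Suc (f x) - g x))"
    by (intro recursive_intros assms)
  moreover have "(\<lambda>x. 1 - (Suc (f x) - g x)) = (\<lambda>x. if f x < g x then 1 else 0)"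
    by auto
  ultimately show ?thesis by (simp add: decidable_def)
qed

lemma decidable_not [recursive_intros]:
  assumes "decidable {x. P x}"
  shows "decidable {x. \<not> P x}"
proof -
  have "recursive_function (\<lambda>x. if P x then 0 else 1)"
    by (intro recursive_intros assms)
  moreover have "(\<lambda>x. if P x then 0 else 1) = (\<lambda>x. if \<not> P x then 1 else 0 :: nat)"
    by auto
  ultimately show ?thesis by (simp add: decidable_def)
qed

lemma decidable_conj [recursive_intros]:
  assumes "decidable {x. P x}" "decidable {x. Q x}"
  shows "decidable {x. P x \<and> Q x}"
proof -
  have "recursive_function (\<lambda>x. if P x then if Q x then 1 else 0 else 0)"
    by (intro recursive_intros assms)
  moreover have "(\<lambda>x. if P x then if Q x then 1 else 0 else 0) = (\<lambda>x. if P x \<and> Q x then 1 else 0 :: nat)"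
    by auto
  ultimately show ?thesis by (simp add: decidable_def)
qed

lemma decidable_disj [recursive_intros]:
  assumes "decidable {x. P x}" "decidable {x. Q x}"
  shows "decidable {x. P x \<or> Q x}"
proof -
  have "decidable {x. \<not> (\<not> P x \<and> \<not> Q x)}"
    by (intro recursive_intros assms)
  then show ?thesis by simp
qed

lemma decidable_bounded_ex [recursive_intros]:
  assumes "decidable {z. P (fst (prod_decode z)) (snd (prod_decode z))}" "recursive_function n"
  shows "decidable {x. \<exists>i<n x. P i x}"
proof -
  \<comment> \<open>The step of the recursion receives the packed triple of index, accumulator and
    parameter; \<open>P\<close> has to skip the accumulator.\<close>
  have "decidable {z. P (fst (prod_decode z)) (snd (prod_decode (snd (prod_decode z))))}"
    using decidable_compose[OF assms(1),
        of "\<lambda>z. prod_encode (fst (prod_decode z), snd (prod_decode (snd (prod_decode z))))"]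
    by (simp add: recursive_intros)
  then have "recursive_function (\<lambda>x. rec_nat 0 (\<lambda>i r. if P i x then 1 else r) (n x))"
    by (intro recursive_intros assms(2))
  moreover have "rec_nat 0 (\<lambda>i r. if P i x then 1 else r) k = (if \<exists>i<k. P i x then 1 else 0 :: nat)"
    for x k
    by (induction k) (auto simp: less_Suc_eq)
  ultimately show ?thesis by (simp add: decidable_def)
qed

lemma decidable_bounded_all [recursive_intros]:
  assumes "decidable {z. P (fst (prod_decode z)) (snd (prod_decode z))}" "recursive_function n"
  shows "decidable {x. \<forall>i<n x. P i x}"
proof -
  have "decidable {x. \<not> (\<exists>i<n x. \<not> P i x)}"
    by (intro recursive_intros assms)
  then show ?thesis by simp
qed

lemma decidable_even [recursive_intros]:
  assumes "recursive_function f"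
  shows "decidable {x. even (f x)}"
proof -
  have "recursive_function (\<lambda>x. rec_nat 1 (\<lambda>i r. 1 - r) (f x))"
    by (intro recursive_intros assms)
  moreover have "rec_nat 1 (\<lambda>i r. 1 - r) k = (if even k then 1 else 0 :: nat)" for k :: nat
    by (induction k) auto
  ultimately show ?thesis by (simp add: decidable_def)
qed

section \<open>Folds over coded lists\<close>

lemma length_le_list_encode: "length xs \<le> list_encode xs"
proof (induction xs)
  case (Cons x xs)
  also have "list_encode xs \<le> prod_encode (x, list_encode xs)" by (rule le_prod_encode_2)
  finally show ?case by simp
qed simp

text \<open>The fold is a primitive recursion on pairs of the code of the remaining list and the
  accumulator. The list code itself serves as the number of iterations: it is at least the length,
  and the step is idle once the remaining code is 0, that is, once the list is empty.\<close>

lemma recursive_foldl [recursive_intros]: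
  assumes l: "recursive_function l" and b: "recursive_function b"
    and s: "recursive_function (\<lambda>z. s (fst (prod_decode z)) (fst (prod_decode (snd (prod_decode z))))
      (snd (prod_decode (snd (prod_decode z)))))"
  shows "recursive_function (\<lambda>c. foldl (\<lambda>a x. s a x c) (b c) (list_decode (l c)))"
proof -
  define step where "step r c = (if fst (prod_decode r) = 0 then r else
      prod_encode (snd (prod_decode (fst (prod_decode r) - 1)),
        s (snd (prod_decode r)) (fst (prod_decode (fst (prod_decode r) - 1))) c))" for r c
  have iter: "rec_nat (prod_encode (list_encode xs, a)) (\<lambda>i r. step r c) n =
      prod_encode (list_encode (drop n xs), foldl (\<lambda>a x. s a x c) a (take n xs))" for xs a c n
  proof (induction n)
    case (Suc n)
    show ?case
    proof (cases "n < length xs")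
      case True
      then show ?thesis
        using Suc by (simp add: step_def take_Suc_conv_app_nth Cons_nth_drop_Suc[symmetric])
    next
      case False
      then show ?thesis using Suc by (simp add: step_def)
    qed
  qed simp
  \<comment> \<open>Unpacks the hypothesis on \<open>s\<close> into a rule for arbitrary recursive
    arguments, which is the form needed for the body of \<open>step\<close>.\<close>
  have s': "recursive_function (\<lambda>z. s (f z) (g z) (h z))"
    if "recursive_function f" "recursive_function g" "recursive_function h" for f g h
    using recursive_compose[OF s, of "\<lambda>z. prod_encode (f z, prod_encode (g z, h z))"] that
    by (simp add: recursive_intros)
  have "recursive_function (\<lambda>c. snd (prod_decode
      (rec_nat (prod_encode (l c, b c)) (\<lambda>i r. step r c) (l c))))"
    unfolding step_def by (intro recursive_intros s' l b)
  moreover have "rec_nat (prod_encode (l c, b c)) (\<lambda>i r. step r c) (l c) =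
      prod_encode (0, foldl (\<lambda>a x. s a x c) (b c) (list_decode (l c)))" for c
    using iter[of "list_decode (l c)" "b c" c "l c"] length_le_list_encode[of "list_decode (l c)"]
    by simp
  ultimately show ?thesis by simp
qed

text \<open>Post's theorem: if a set and its complement are both projections of decidable relations,
  one unbounded search for a witness of either kind always halts, and the kind of witness found
  gives the answer.\<close>

lemma decidable_of_searches:
  assumes P: "decidable {z. P (fst (prod_decode z)) (snd (prod_decode z))}"
    and Q: "decidable {z. Q (fst (prod_decode z)) (snd (prod_decode z))}"
    and A: "\<And>x. x \<in> A \<longleftrightarrow> (\<exists>t. P t x)" "\<And>x. x \<notin> A \<longleftrightarrow> (\<exists>t. Q t x)"
  shows "decidable A"
proof -
  define f where "f t x = (if P t x \<or> Q t x then 0 else 1 :: nat)" for t x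
  have "recursive_function (\<lambda>z. f (fst (prod_decode z)) (snd (prod_decode z)))"
    unfolding f_def by (intro recursive_intros P Q)
  then obtain p e where "\<And>z. computes p [z] (f (fst (prod_decode z)) (snd (prod_decode z)))"
    and "\<And>m n. computes e [m, n] (prod_encode (m, n))"
    using binary_recursive_prod_encode
    unfolding recursive_function_def binary_recursive_def by blast
  then have "computes (Comp p [e]) [m, n] (f m n)" for m n
    by (metis computes_Comp1 fst_conv prod_encode_inverse snd_conv)
  then have "binary_recursive f" unfolding binary_recursive_def by blast
  moreover have ex: "\<exists>t. f t x = 0" for x
    using A[of x] by (cases "x \<in> A") (auto simp: f_def)
  ultimately have g: "recursive_function (\<lambda>x. LEAST t. f t x = 0)"
    by (rule recursive_minimize)
  have "P (LEAST t. f t x = 0) x \<or> Q (LEAST t. f t x = 0) x" for x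
    using LeastI_ex[OF ex[of x]] unfolding f_def by (auto split: if_splits)
  \<comment> \<open>A witness for \<open>Q\<close> excludes membership in \<open>A\<close>, so
    testing \<open>P\<close> at the found witness decides which case occurred.\<close>
  then have "A = {x. P (LEAST t. f t x = 0) x}"
    using A by blast
  moreover have "decidable {x. P (LEAST t. f t x = 0) x}"
    using decidable_compose[OF P recursive_prod_encode[OF g recursive_id]] by simp
  ultimately show ?thesis by simp
qed

section \<open>Word operations on codes\<close>

definition word_decode :: "nat \<Rightarrow> nat gword" where
  "word_decode n = map sum_decode (list_decode n)"

lemma word_code_decode [simp]: "word_code (word_decode n) = n"
  by (simp add: word_code_def word_decode_def comp_def)

lemma word_decode_code [simp]: "word_decode (word_code w) = w"
  by (simp add: word_code_def word_decode_def comp_def)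

lemma word_code_Cons: "word_code (x # w) = Suc (prod_encode (sum_encode x, word_code w))"
  by (simp add: word_code_def)

lemma word_code_Nil: "word_code [] = 0"
  by (simp add: word_code_def)

lemma inj_word_code: "inj word_code"
  by (metis injI word_decode_code)

lemma word_code_eq_iff [simp]: "word_code v = word_code w \<longleftrightarrow> v = w"
  using inj_word_code by (auto dest: injD)

text \<open>\<open>sum_encode\<close> maps \<open>Inl s\<close> to \<open>2 * s\<close> and
  \<open>Inr s\<close> to \<open>2 * s + 1\<close>, so inverting a letter exchanges an even number
  with its successor.\<close>

definition letter_inv_code :: "nat \<Rightarrow> nat" where
  "letter_inv_code a = (if even a then Suc a else a - 1)"

lemma letter_inv_code: "letter_inv_code (sum_encode x) = sum_encode (letter_inv x)"
  by (cases x) (simp_all add: letter_inv_code_def sum_encode_def)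

lemma recursive_letter_inv_code [recursive_intros]:
  "recursive_function f \<Longrightarrow> recursive_function (\<lambda>x. letter_inv_code (f x))"
  unfolding letter_inv_code_def by (intro recursive_intros)

text \<open>The code 0 is the empty word; any other code is \<open>Suc\<close> of a pair of head and
  tail, so \<open>l - 1\<close> decodes to these two.\<close>

definition reduced_cons_code :: "nat \<Rightarrow> nat \<Rightarrow> nat" where
  "reduced_cons_code a l = (if l = 0 then Suc (prod_encode (a, 0))
    else if fst (prod_decode (l - 1)) = letter_inv_code a then snd (prod_decode (l - 1))
    else Suc (prod_encode (a, l)))"

lemma reduced_cons_code:
  "reduced_cons_code (sum_encode x) (word_code w) = word_code (reduced_cons x w)"
proof (cases w)
  case (Cons y w')
  have "sum_encode y = sum_encode (letter_inv x) \<longleftrightarrow> y = letter_inv x"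
    by (metis sum_encode_inverse)
  then show ?thesis
    by (simp add: reduced_cons_code_def Cons word_code_Cons letter_inv_code)
qed (simp add: reduced_cons_code_def word_code_Cons word_code_Nil)

lemma recursive_reduced_cons_code [recursive_intros]:
  "recursive_function f \<Longrightarrow> recursive_function g \<Longrightarrow>
    recursive_function (\<lambda>x. reduced_cons_code (f x) (g x))"
  unfolding reduced_cons_code_def by (intro recursive_intros)

text \<open>A left-to-right fold that pushes letters onto the front reverses the word by
  itself.\<close>

definition word_inv_code :: "nat \<Rightarrow> nat" where
  "word_inv_code u = foldl (\<lambda>l a. Suc (prod_encode (letter_inv_code a, l))) 0 (list_decode u)"

lemma word_inv_code: "word_inv_code (word_code u) = word_code (word_inv u)"
proof -
  have "foldl (\<lambda>l a. Suc (prod_encode (letter_inv_code a, l))) (word_code v) (map sum_encode u)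
      = word_code (word_inv u @ v)" for v
    by (induction u arbitrary: v)
      (simp_all add: word_inv_def letter_inv_code word_code_Cons[symmetric])
  from this[of "[]"] show ?thesis
    by (simp add: word_inv_code_def word_code_Nil) (simp add: word_code_def)
qed

lemma recursive_word_inv_code [recursive_intros]:
  "recursive_function f \<Longrightarrow> recursive_function (\<lambda>x. word_inv_code (f x))"
  unfolding word_inv_code_def by (intro recursive_intros)

text \<open>Multiplication by an inverse on the left consumes the word from its head, hence the
  left-to-right fold.\<close>

definition inv_append_code :: "nat \<Rightarrow> nat \<Rightarrow> nat" where
  "inv_append_code u v = foldl (\<lambda>l a. reduced_cons_code (letter_inv_code a) l) v (list_decode u)"

lemma inv_append_code:
  "inv_append_code (word_code u) (word_code (free_reduce v)) = word_code (free_reduce (word_inv u @ v))"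
proof -
  have "foldl (\<lambda>l a. reduced_cons_code (letter_inv_code a) l) (word_code v) (map sum_encode u)
      = word_code (foldr reduced_cons (word_inv u) v)" for v
    by (induction u arbitrary: v)
      (simp_all add: word_inv_def letter_inv_code reduced_cons_code)
  then show ?thesis
    by (simp add: inv_append_code_def free_reduce_append) (simp add: word_code_def)
qed

lemma recursive_inv_append_code [recursive_intros]:
  "recursive_function f \<Longrightarrow> recursive_function g \<Longrightarrow>
    recursive_function (\<lambda>x. inv_append_code (f x) (g x))"
  unfolding inv_append_code_def by (intro recursive_intros)

text \<open>Reduction is a right fold, whereas only left folds are available on codes. Multiplying
  the empty word by the inverse of the inverse of \<open>u\<close> replaces the one by the
  other.\<close>

definition free_reduce_code :: "nat \<Rightarrow> nat" where
  "free_reduce_code u = inv_append_code (word_inv_code u) 0"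

lemma word_inv_word_inv [simp]: "word_inv (word_inv w) = w"
  by (simp add: word_inv_def rev_map comp_def)

lemma free_reduce_code: "free_reduce_code (word_code u) = word_code (free_reduce u)"
  using inv_append_code[of "word_inv u" "[]"]
  by (simp add: free_reduce_code_def word_inv_code word_code_Nil free_reduce_def)

lemma recursive_free_reduce_code [recursive_intros]:
  "recursive_function f \<Longrightarrow> recursive_function (\<lambda>x. free_reduce_code (f x))"
  unfolding free_reduce_code_def by (intro recursive_intros)

text \<open>A certificate is a list of items \<open>(u, s, j)\<close>; an item multiplies the current word
  on the left by \<open>u\<^sup>-\<^sup>1 r u\<close> or \<open>u\<^sup>-\<^sup>1 r\<^sup>-\<^sup>1 u\<close>, where \<open>s\<close>
  chooses the sign and \<open>r\<close> is the extra relator \<open>x\<close> if \<open>j = 0\<close> and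
  the relator number \<open>j - 1\<close> otherwise.\<close>

definition relator_code :: "(nat \<Rightarrow> nat) \<Rightarrow> nat \<Rightarrow> nat \<Rightarrow> nat" where
  "relator_code f x j = (if j = 0 then x else f (j - 1))"

definition certificate_step :: "(nat \<Rightarrow> nat) \<Rightarrow> nat \<Rightarrow> nat \<Rightarrow> nat \<Rightarrow> nat" where
  "certificate_step f x v t =
    inv_append_code (fst (prod_decode t))
      (inv_append_code
        (if fst (prod_decode (snd (prod_decode t))) = 0
         then word_inv_code (relator_code f x (snd (prod_decode (snd (prod_decode t)))))
         else relator_code f x (snd (prod_decode (snd (prod_decode t)))))
        (inv_append_code (word_inv_code (fst (prod_decode t))) v))"

definition run_certificate :: "(nat \<Rightarrow> nat) \<Rightarrow> nat \<Rightarrow> nat \<Rightarrow> nat \<Rightarrow> nat" where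
  "run_certificate f x c v = foldl (certificate_step f x) v (list_decode c)"

lemma recursive_run_certificate:
  assumes "recursive_function f" "recursive_function x" "recursive_function c" "recursive_function v"
  shows "recursive_function (\<lambda>n. run_certificate f (x n) (c n) (v n))"
proof -
  have "recursive_function (\<lambda>n. foldl (\<lambda>a t. certificate_step f (x n) a t) (v n) (list_decode (c n)))"
    unfolding certificate_step_def relator_code_def
    by (intro recursive_intros recursive_compose[OF assms(1)] recursive_compose[OF assms(2)] assms(3,4))
  then show ?thesis by (simp add: run_certificate_def)
qed

lemma run_certificate_0: "run_certificate f x 0 v = v"
  by (simp add: run_certificate_def)

lemma run_certificate_append:
  "run_certificate f x (list_encode (list_decode c @ list_decode d)) v
    = run_certificate f x d (run_certificate f x c v)"
  by (simp add: run_certificate_def)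

text \<open>The current word must be reduced for \<open>inv_append_code\<close> to give a reduced
  result. Each of the three factors is handed over inverted, which is why sign 0, where the code of
  the inverse of \<open>r\<close> is passed, multiplies by \<open>r\<close> itself.\<close>

lemma run_certificate_single:
  assumes "v = word_code (free_reduce w)" "r = word_decode (relator_code f x j)"
  shows "run_certificate f x (list_encode [prod_encode (word_code u, prod_encode (s, j))]) v
    = word_code (free_reduce (word_inv u @ (if s = 0 then r else word_inv r) @ u @ w))"
proof -
  have r: "relator_code f x j = word_code r" using assms(2) by simp
  show ?thesis
    by (simp add: run_certificate_def certificate_step_def r assms(1) word_inv_code inv_append_code)
qed

section \<open>Products of conjugates\<close>

text \<open>An explicit form of the normal closure. A new conjugate enters on the left, just as one
  item of a certificate acts on the current word.\<close>

inductive_set conjugate_products :: "('g, 'm) monoid_scheme \<Rightarrow> 'g set \<Rightarrow> 'g set"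
  for G (structure) and A where
  one: "\<one> \<in> conjugate_products G A"
| conj: "g \<in> carrier G \<Longrightarrow> a \<in> A \<Longrightarrow> k \<in> conjugate_products G A \<Longrightarrow>
    inv g \<otimes> a \<otimes> g \<otimes> k \<in> conjugate_products G A"
| conj_inv: "g \<in> carrier G \<Longrightarrow> a \<in> A \<Longrightarrow> k \<in> conjugate_products G A \<Longrightarrow>
    inv g \<otimes> inv a \<otimes> g \<otimes> k \<in> conjugate_products G A"

context group
begin

lemma conjugate_products_closed:
  assumes "A \<subseteq> carrier G" "k \<in> conjugate_products G A"
  shows "k \<in> carrier G"
  using assms(2) by induction (use assms(1) in auto)

lemma conjugate_products_mult:
  assumes A: "A \<subseteq> carrier G" and "k \<in> conjugate_products G A" "l \<in> conjugate_products G A"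
  shows "k \<otimes> l \<in> conjugate_products G A"
  using assms(2)
proof induction
  case one
  show ?case using assms conjugate_products_closed by simp
next
  case (conj g a k)
  have "inv g \<otimes> a \<otimes> g \<otimes> k \<otimes> l = inv g \<otimes> a \<otimes> g \<otimes> (k \<otimes> l)"
    using conj A assms(3) conjugate_products_closed[OF A] by (simp add: m_assoc subset_iff)
  then show ?case using conj conjugate_products.conj by metis
next
  case (conj_inv g a k)
  have "inv g \<otimes> inv a \<otimes> g \<otimes> k \<otimes> l = inv g \<otimes> inv a \<otimes> g \<otimes> (k \<otimes> l)"
    using conj_inv A assms(3) conjugate_products_closed[OF A] by (simp add: m_assoc subset_iff)
  then show ?case using conj_inv conjugate_products.conj_inv by metis
qed

lemma conjugate_products_inv:
  assumes A: "A \<subseteq> carrier G" and "k \<in> conjugate_products G A"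
  shows "inv k \<in> conjugate_products G A"
  using assms(2)
proof induction
  case one
  show ?case using conjugate_products.one by simp
next
  case (conj g a k)
  have "inv k \<otimes> (inv g \<otimes> inv a \<otimes> g \<otimes> \<one>) \<in> conjugate_products G A"
    using conj by (intro conjugate_products_mult[OF A] conjugate_products.intros)
  moreover have "inv (inv g \<otimes> a \<otimes> g \<otimes> k) = inv k \<otimes> (inv g \<otimes> inv a \<otimes> g \<otimes> \<one>)"
    using conj A conjugate_products_closed[OF A] by (simp add: m_assoc subset_iff inv_mult_group)
  ultimately show ?case by simp
next
  case (conj_inv g a k)
  have "inv k \<otimes> (inv g \<otimes> a \<otimes> g \<otimes> \<one>) \<in> conjugate_products G A"
    using conj_inv by (intro conjugate_products_mult[OF A] conjugate_products.intros)
  moreover have "inv (inv g \<otimes> inv a \<otimes> g \<otimes> k) = inv k \<otimes> (inv g \<otimes> a \<otimes> g \<otimes> \<one>)"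
    using conj_inv A conjugate_products_closed[OF A] by (simp add: m_assoc subset_iff inv_mult_group)
  ultimately show ?case by simp
qed

text \<open>Conjugation by \<open>h\<close> only changes the conjugator of the leading factor from
  \<open>g\<close> to \<open>g \<otimes> inv h\<close>, so it preserves the shape of the product and
  leaves the rest to the induction hypothesis.\<close>

lemma conjugate_identity:
  assumes "h \<in> carrier G" "g \<in> carrier G" "a \<in> carrier G" "k \<in> carrier G"
  shows "h \<otimes> (inv g \<otimes> a \<otimes> g \<otimes> k) \<otimes> inv h = inv (g \<otimes> inv h) \<otimes> a \<otimes> (g \<otimes> inv h) \<otimes> (h \<otimes> k \<otimes> inv h)"
proof -
  have "inv h \<otimes> (h \<otimes> (k \<otimes> inv h)) = k \<otimes> inv h"
    using assms by (simp add: m_assoc[symmetric])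
  then show ?thesis using assms by (simp add: m_assoc inv_mult_group)
qed

lemma conjugate_products_conjugate:
  assumes A: "A \<subseteq> carrier G" and h: "h \<in> carrier G" and "k \<in> conjugate_products G A"
  shows "h \<otimes> k \<otimes> inv h \<in> conjugate_products G A"
  using assms(3)
proof induction
  case one
  show ?case using conjugate_products.one h by simp
next
  case (conj g a k)
  then have "a \<in> carrier G" "k \<in> carrier G" using A conjugate_products_closed by auto
  then show ?case
    using conj h by (simp only: conjugate_identity) (intro conjugate_products.conj, auto)
next
  case (conj_inv g a k)
  then have "inv a \<in> carrier G" "k \<in> carrier G" using A conjugate_products_closed by auto
  then show ?case
    using conj_inv h by (simp only: conjugate_identity) (intro conjugate_products.conj_inv, auto)
qed

text \<open>The products form a normal subgroup containing \<open>A\<close>, which gives one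
  inclusion; the other is an induction, as each normal subgroup containing \<open>A\<close> is
  closed under the rules that build the products.\<close>

lemma normal_closure_eq_conjugate_products:
  assumes A: "A \<subseteq> carrier G"
  shows "normal_closure G A = conjugate_products G A"
proof
  have "conjugate_products G A \<noteq> {}"
    using conjugate_products.one[of G A] by auto
  then have "subgroup (conjugate_products G A) G"
    using conjugate_products_closed[OF A] conjugate_products_mult[OF A]
      conjugate_products_inv[OF A]
    by (intro subgroupI) auto
  then have "conjugate_products G A \<lhd> G"
    using conjugate_products_conjugate[OF A] by (auto simp: normal_inv_iff)
  moreover have "A \<subseteq> conjugate_products G A"
  proof
    fix a assume "a \<in> A"
    then have "inv \<one> \<otimes> a \<otimes> \<one> \<otimes> \<one> \<in> conjugate_products G A"
      by (intro conjugate_products.intros) auto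
    then show "a \<in> conjugate_products G A" using \<open>a \<in> A\<close> A by auto
  qed
  ultimately show "normal_closure G A \<subseteq> conjugate_products G A"
    unfolding normal_closure_def by blast
next
  show "conjugate_products G A \<subseteq> normal_closure G A"
  proof
    fix k assume "k \<in> conjugate_products G A"
    then have "k \<in> N" if N: "N \<lhd> G" "A \<subseteq> N" for N
    proof induction
      interpret N: normal N G by (rule N)
      case one
      show ?case by simp
    next
      interpret N: normal N G by (rule N)
      case (conj g a k)
      then show ?case using N(2) N.inv_op_closed1[of g a] by auto
    next
      interpret N: normal N G by (rule N)
      case (conj_inv g a k)
      then show ?case using N(2) N.inv_op_closed1[of g "inv a"] by auto
    qed
    then show "k \<in> normal_closure G A" unfolding normal_closure_def by blast
  qed
qed

end

section \<open>Values of words\<close>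

lemma mult_free_group: "u \<otimes>\<^bsub>free_group\<^esub> v = free_reduce (u @ v)"
  by (simp add: free_group_def)

lemma one_free_group: "\<one>\<^bsub>free_group\<^esub> = []"
  by (simp add: free_group_def)

lemma mult_free_reduce: "free_reduce u \<otimes>\<^bsub>free_group\<^esub> free_reduce v = free_reduce (u @ v)"
  by (simp add: mult_free_group free_reduce_append_left free_reduce_append_right)

lemma inv_free_reduce: "inv\<^bsub>free_group\<^esub> free_reduce w = free_reduce (word_inv w)"
proof -
  interpret F: group "free_group :: 'a gword monoid" by (rule group_free_group)
  show ?thesis
    by (intro F.inv_equality)
      (simp_all add: mult_free_reduce free_reduce_word_inv one_free_group free_reduce_closed)
qed

lemma carrier_free_group: "carrier free_group = range free_reduce"
proof
  show "carrier free_group \<subseteq> range free_reduce"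
    by (metis free_reduce_id rangeI subsetI)
qed (auto simp: free_reduce_closed)

lemma word_value_in_carrier: "word_value S w \<in> carrier (presented_group S)"
  by (auto simp: presented_group_def word_value_def carrier_FactGroup free_reduce_closed)

lemma carrier_presented_group: "carrier (presented_group S) = range (word_value S)"
  by (simp add: presented_group_def word_value_def[abs_def] carrier_FactGroup carrier_free_group
      image_image)

lemma word_value_append:
  "word_value S (u @ v) = word_value S u \<otimes>\<^bsub>presented_group S\<^esub> word_value S v"
proof -
  interpret N: normal "relator_subgroup S" free_group by (rule relator_subgroup_normal)
  show ?thesis
    by (simp add: presented_group_def word_value_def N.rcos_sum free_reduce_closed mult_free_reduce)
qed

lemma word_value_eq_iff:
  "word_value S v = word_value S w \<longleftrightarrow>
    free_reduce w \<otimes>\<^bsub>free_group\<^esub> inv\<^bsub>free_group\<^esub> free_reduce v \<in> relator_subgroup S"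
proof -
  interpret N: normal "relator_subgroup S" free_group by (rule relator_subgroup_normal)
  show ?thesis
    unfolding word_value_def
    using N.rcos_module[OF N.is_group free_reduce_closed free_reduce_closed, of w v]
      N.repr_independence[OF _ free_reduce_closed N.is_subgroup]
      N.repr_independenceD[OF N.is_subgroup free_reduce_closed]
    by metis
qed

lemma word_value_Nil: "word_value S [] = \<one>\<^bsub>presented_group S\<^esub>"
proof -
  interpret N: normal "relator_subgroup S" free_group by (rule relator_subgroup_normal)
  show ?thesis
    using N.coset_mult_one[OF N.subset]
    by (simp add: presented_group_def word_value_def free_reduce_def one_free_group)
qed

lemma word_value_word_inv: "word_value S (word_inv w) = inv\<^bsub>presented_group S\<^esub> word_value S w"
proof -
  interpret G: group "presented_group S" by (rule group_presented_group)
  have "word_value S (word_inv w @ w) = word_value S []"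
    using free_reduce_word_inv[of w] by (simp add: word_value_def free_reduce_def)
  then show ?thesis
    by (metis G.inv_equality word_value_Nil word_value_append word_value_in_carrier)
qed

section \<open>Trivial words and added relators\<close>

lemma relator_subgroup_conjugate_products:
  "relator_subgroup S = conjugate_products free_group (free_reduce ` S)"
  unfolding relator_subgroup_def
  by (rule group.normal_closure_eq_conjugate_products[OF group_free_group])
    (auto simp: free_reduce_closed)

lemma word_value_one_iff:
  "word_value S w = \<one>\<^bsub>presented_group S\<^esub> \<longleftrightarrow> free_reduce w \<in> relator_subgroup S"
proof -
  interpret F: group "free_group :: 'a gword monoid" by (rule group_free_group)
  have "free_reduce w \<otimes>\<^bsub>free_group\<^esub> inv\<^bsub>free_group\<^esub> free_reduce [] = free_reduce w"
    using F.inv_one F.r_one[OF free_reduce_closed]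
    by (simp add: free_reduce_def[of "[]"] one_free_group)
  then show ?thesis
    using word_value_eq_iff[of S "[]" w] by (auto simp: word_value_Nil)
qed

lemma word_value_relator: "r \<in> S \<Longrightarrow> word_value S r = \<one>\<^bsub>presented_group S\<^esub>"
  unfolding word_value_one_iff relator_subgroup_def normal_closure_def by auto

lemma relator_subgroup_mono: "S \<subseteq> T \<Longrightarrow> relator_subgroup S \<subseteq> relator_subgroup T"
  unfolding relator_subgroup_def normal_closure_def by (intro Inter_anti_mono) auto

text \<open>A trivial \<open>x\<close> reduces into the relator subgroup of \<open>S\<close>, which
  is therefore one of the normal subgroups intersected for the enlarged relator set.\<close>

lemma relator_subgroup_insert:
  assumes "word_value S x = \<one>\<^bsub>presented_group S\<^esub>"
  shows "relator_subgroup (insert x S) = relator_subgroup S"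
proof
  have "free_reduce ` S \<subseteq> relator_subgroup S"
    unfolding relator_subgroup_def normal_closure_def by auto
  then have "free_reduce ` insert x S \<subseteq> relator_subgroup S"
    using assms by (simp add: word_value_one_iff)
  then show "relator_subgroup (insert x S) \<subseteq> relator_subgroup S"
    unfolding relator_subgroup_def[of "insert x S"] normal_closure_def
    using relator_subgroup_normal by blast
qed (intro relator_subgroup_mono subset_insertI)

section \<open>Certificates and equality of words\<close>

lemma word_value_conjugate_relator:
  assumes "r \<in> S"
  shows "word_value S (word_inv u @ r @ u @ w) = word_value S w"
    "word_value S (word_inv u @ word_inv r @ u @ w) = word_value S w"
proof -
  interpret G: group "presented_group S" by (rule group_presented_group)
  have "word_value S r = \<one>\<^bsub>presented_group S\<^esub>"
    by (rule word_value_relator[OF assms])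
  then show "word_value S (word_inv u @ r @ u @ w) = word_value S w"
    "word_value S (word_inv u @ word_inv r @ u @ w) = word_value S w"
    by (simp_all add: word_value_append word_value_word_inv word_value_in_carrier G.m_assoc[symmetric])
qed

text \<open>Every item multiplies by a conjugate of a relator or of its inverse, which is trivial
  modulo the extended relators. Passing to some \<open>w'\<close> whose reduction is the current
  word keeps the induction hypothesis applicable.\<close>

lemma run_certificate_sound:
  assumes f: "word_code ` R = range f"
  shows "\<exists>w'. run_certificate f (word_code x) c (word_code (free_reduce w)) = word_code (free_reduce w')
    \<and> word_value (insert x R) w' = word_value (insert x R) w"
proof -
  have "\<exists>w'. foldl (certificate_step f (word_code x)) (word_code (free_reduce w)) ts
      = word_code (free_reduce w') \<and> word_value (insert x R) w' = word_value (insert x R) w" for ts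
  proof (induction ts arbitrary: w)
    case (Cons t ts)
    obtain u s j where t: "t = prod_encode (word_code u, prod_encode (s, j))"
      by (metis prod_decode_inverse surj_pair word_code_decode)
    define r where "r = word_decode (relator_code f (word_code x) j)"
    have r: "r \<in> insert x R"
    proof (cases "j = 0")
      case False
      have "f (j - 1) \<in> word_code ` R" using f by auto
      then show ?thesis using False by (auto simp: r_def relator_code_def)
    qed (simp add: r_def relator_code_def)
    let ?w = "word_inv u @ (if s = 0 then r else word_inv r) @ u @ w"
    have "certificate_step f (word_code x) (word_code (free_reduce w)) t = word_code (free_reduce ?w)"
      using run_certificate_single[OF refl r_def, where u = u and s = s and w = w] by (simp add: t run_certificate_def)
    moreover have "word_value (insert x R) ?w = word_value (insert x R) w"
      using word_value_conjugate_relator[OF r] by simp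
    ultimately show ?case using Cons.IH[of ?w] by simp
  qed auto
  then show ?thesis by (simp add: run_certificate_def)
qed

lemma free_reduce_conjugate_product:
  "free_reduce ((inv\<^bsub>free_group\<^esub> free_reduce g \<otimes>\<^bsub>free_group\<^esub> free_reduce r
      \<otimes>\<^bsub>free_group\<^esub> free_reduce g \<otimes>\<^bsub>free_group\<^esub> k) @ v)
    = free_reduce (word_inv g @ r @ g @ k @ v)"
  "free_reduce ((inv\<^bsub>free_group\<^esub> free_reduce g \<otimes>\<^bsub>free_group\<^esub> inv\<^bsub>free_group\<^esub> free_reduce r
      \<otimes>\<^bsub>free_group\<^esub> free_reduce g \<otimes>\<^bsub>free_group\<^esub> k) @ v)
    = free_reduce (word_inv g @ word_inv r @ g @ k @ v)"
  by (simp_all add: inv_free_reduce mult_free_reduce)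
    (simp_all add: mult_free_group free_reduce_append_left)

lemma relator_code_surj:
  assumes "word_code ` R = range f" "r \<in> insert x R"
  shows "\<exists>j. r = word_decode (relator_code f (word_code x) j)"
proof (cases "r = x")
  case True
  then show ?thesis by (intro exI[of _ 0]) (simp add: relator_code_def)
next
  case False
  then obtain i where "word_code r = f i" using assms by auto
  then have "r = word_decode (f i)" by (metis word_decode_code)
  then show ?thesis by (intro exI[of _ "Suc i"]) (simp add: relator_code_def)
qed

text \<open>The certificate follows the inductive construction of \<open>k\<close>: the rightmost
  factors act on \<open>v\<close> first, so the item for a new leading factor goes to the end of the
  list.\<close>

lemma run_certificate_complete:
  assumes f: "word_code ` R = range f"
    and k: "k \<in> conjugate_products free_group (free_reduce ` insert x R)"
  shows "\<exists>c. run_certificate f (word_code x) c (word_code (free_reduce v)) = word_code (free_reduce (k @ v))"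
  using k
proof induction
  case one
  show ?case by (metis append_Nil one_free_group run_certificate_0)
next
  case (conj g a k)
  let ?k = "inv\<^bsub>free_group\<^esub> g \<otimes>\<^bsub>free_group\<^esub> a \<otimes>\<^bsub>free_group\<^esub> g \<otimes>\<^bsub>free_group\<^esub> k"
  from conj obtain c r where c: "run_certificate f (word_code x) c (word_code (free_reduce v))
      = word_code (free_reduce (k @ v))" and r: "r \<in> insert x R" "a = free_reduce r" by auto
  then obtain j where j: "r = word_decode (relator_code f (word_code x) j)" using relator_code_surj[OF f] by blast
  have "free_reduce (word_inv g @ r @ g @ k @ v) = free_reduce (?k @ v)"
    using free_reduce_conjugate_product(1)[of g r k v] free_reduce_id[OF conj.hyps(1)] r(2) by simp
  then have "run_certificate f (word_code x) (list_encode [prod_encode (word_code g, prod_encode (0, j))])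
      (word_code (free_reduce (k @ v))) = word_code (free_reduce (?k @ v))"
    using run_certificate_single[OF refl j, where w = "k @ v" and u = g and s = 0] by simp
  then show ?case by (metis c run_certificate_append)
next
  case (conj_inv g a k)
  let ?k = "inv\<^bsub>free_group\<^esub> g \<otimes>\<^bsub>free_group\<^esub> inv\<^bsub>free_group\<^esub> a \<otimes>\<^bsub>free_group\<^esub> g
    \<otimes>\<^bsub>free_group\<^esub> k"
  from conj_inv obtain c r where c: "run_certificate f (word_code x) c (word_code (free_reduce v))
      = word_code (free_reduce (k @ v))" and r: "r \<in> insert x R" "a = free_reduce r" by auto
  then obtain j where j: "r = word_decode (relator_code f (word_code x) j)" using relator_code_surj[OF f] by blast
  have "free_reduce (word_inv g @ word_inv r @ g @ k @ v) = free_reduce (?k @ v)"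
    using free_reduce_conjugate_product(2)[of g r k v] free_reduce_id[OF conj_inv.hyps(1)] r(2)
    by simp
  then have "run_certificate f (word_code x) (list_encode [prod_encode (word_code g, prod_encode (1, j))])
      (word_code (free_reduce (k @ v))) = word_code (free_reduce (?k @ v))"
    using run_certificate_single[OF refl j, where w = "k @ v" and u = g and s = 1] by simp
  then show ?case by (metis c run_certificate_append)
qed

lemma run_certificate_iff:
  assumes f: "word_code ` R = range f"
  shows "(\<exists>c. run_certificate f (word_code x) c (word_code (free_reduce v)) = word_code (free_reduce w))
    \<longleftrightarrow> word_value (insert x R) v = word_value (insert x R) w"
proof
  assume "\<exists>c. run_certificate f (word_code x) c (word_code (free_reduce v)) = word_code (free_reduce w)"
  then obtain w' where "free_reduce w' = free_reduce w"
    "word_value (insert x R) w' = word_value (insert x R) v"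
    using run_certificate_sound[OF f] by (metis word_code_eq_iff)
  then show "word_value (insert x R) v = word_value (insert x R) w"
    by (simp add: word_value_def)
next
  interpret F: group "free_group :: nat gword monoid" by (rule group_free_group)
  \<comment> \<open>The quotient of the two words: multiplying \<open>v\<close> by it on the left
    yields \<open>w\<close>, and equality of values makes it a product of conjugates, hence realised
    by a certificate.\<close>
  define k where "k = free_reduce w \<otimes>\<^bsub>free_group\<^esub> inv\<^bsub>free_group\<^esub> free_reduce v"
  assume "word_value (insert x R) v = word_value (insert x R) w"
  then have "k \<in> conjugate_products free_group (free_reduce ` insert x R)"
    by (simp only: word_value_eq_iff k_def relator_subgroup_conjugate_products)
  moreover have "k \<otimes>\<^bsub>free_group\<^esub> free_reduce v = free_reduce w"
    by (simp add: k_def F.m_assoc free_reduce_closed)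
  then have "free_reduce (k @ v) = free_reduce w"
    by (simp add: mult_free_group free_reduce_append_right)
  ultimately show "\<exists>c. run_certificate f (word_code x) c (word_code (free_reduce v)) = word_code (free_reduce w)"
    using run_certificate_complete[OF f] by metis
qed

section \<open>Quotients of the presented group\<close>

text \<open>The value of \<open>x\<close> is a non-trivial element of the kernel of the natural
  surjection onto the group with the additional relator. Just infiniteness makes the quotient by
  this kernel finite, and that quotient maps onto the new group.\<close>

lemma finite_word_values_insert:
  assumes G: "just_infinite (presented_group R)" and x: "word_value R x \<noteq> \<one>\<^bsub>presented_group R\<^esub>"
  shows "finite (range (word_value (insert x R)))"
proof -
  let ?G = "presented_group R" and ?H = "presented_group (insert x R)"
  \<comment> \<open>The natural map: values that agree modulo \<open>R\<close> agree modulo the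
    larger relator set, so any chosen representative gives the same result.\<close>
  obtain w0 where w0: "word_value (insert x R) w = w0 (word_value R w)" for w
  proof
    fix w
    have "word_value R v = word_value R w \<Longrightarrow> word_value (insert x R) v = word_value (insert x R) w" for v
      using relator_subgroup_mono[of R "insert x R"] by (auto simp: word_value_eq_iff)
    then show "word_value (insert x R) w
        = (\<lambda>C. word_value (insert x R) (SOME v. word_value R v = C)) (word_value R w)"
      by (metis (mono_tags, lifting) someI_ex)
  qed
  have "w0 \<in> hom ?G ?H"
    by (rule homI)
      (auto simp: carrier_presented_group w0[symmetric] word_value_append[symmetric])
  then interpret h: group_hom ?G ?H w0
    by (intro group_hom.intro group_presented_group group_hom_axioms.intro)
  have "word_value R x \<in> kernel ?G ?H w0"
    using word_value_relator[of x "insert x R"]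
    by (simp add: kernel_def word_value_in_carrier w0[symmetric])
  then have "kernel ?G ?H w0 \<noteq> {\<one>\<^bsub>?G\<^esub>}" using x by auto
  then have "finite (carrier (?G Mod kernel ?G ?H w0))"
    using G h.normal_kernel unfolding just_infinite_def by blast
  moreover have "w0 ` carrier ?G = carrier ?H"
    by (simp add: carrier_presented_group image_image w0[symmetric])
  ultimately have "finite (carrier ?H)"
    using h.FactGroup_onto by (metis finite_imageI)
  then show ?thesis by (simp add: carrier_presented_group)
qed

text \<open>The letters with code below \<open>2 * m\<close> are the first \<open>m\<close> generators and
  their inverses.\<close>

lemma infinite_word_values_finite_alphabet:
  assumes "\<not> locally_finite (presented_group R)"
  shows "\<exists>m. infinite (word_value R ` {w. \<forall>a\<in>set w. sum_encode a < 2 * m})"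
proof -
  let ?G = "presented_group R" and ?W = "\<lambda>m. {w. \<forall>a\<in>set w. sum_encode a < 2 * m}"
  interpret G: group ?G by (rule group_presented_group)
  obtain A where A: "finite A" "A \<subseteq> range (word_value R)" "infinite (generate ?G A)"
    using assms G.is_group unfolding locally_finite_def carrier_presented_group by blast
  then obtain B where B: "finite B" "A = word_value R ` B"
    by (meson finite_subset_image)
  have "finite (\<Union>w\<in>B. sum_encode ` set w)" using B by auto
  \<comment> \<open>Finitely many words represent the elements of \<open>A\<close>, and
    \<open>m\<close> exceeds the codes of all their letters; these are then also below
    \<open>2 * m\<close>.\<close>
  then obtain m where m: "\<And>n. n \<in> (\<Union>w\<in>B. sum_encode ` set w) \<Longrightarrow> n < m"
    by (metis finite_nat_set_iff_bounded)
  \<comment> \<open>The bound is even, so it never separates the code of a generator from that of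
    its inverse.\<close>
  have inv: "sum_encode (letter_inv a) < 2 * m" if "sum_encode a < 2 * m" for a
    using that by (cases a) (auto simp: sum_encode_def)
  have "subgroup (word_value R ` ?W m) ?G"
  proof (rule G.subgroupI)
    show "word_value R ` ?W m \<subseteq> carrier ?G" by (auto simp: word_value_in_carrier)
    have "[] \<in> ?W m" by simp
    then show "word_value R ` ?W m \<noteq> {}" by blast
  next
    fix g assume "g \<in> word_value R ` ?W m"
    then obtain w where w: "w \<in> ?W m" "g = word_value R w" by blast
    then have "word_inv w \<in> ?W m" using inv by (auto simp: word_inv_def)
    then show "inv\<^bsub>?G\<^esub> g \<in> word_value R ` ?W m"
      unfolding w word_value_word_inv[symmetric] by blast
  next
    fix g h assume "g \<in> word_value R ` ?W m" "h \<in> word_value R ` ?W m"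
    then obtain v w where "v \<in> ?W m" "w \<in> ?W m" and gh: "g = word_value R v" "h = word_value R w" by blast
    then have "v @ w \<in> ?W m" by auto
    then show "g \<otimes>\<^bsub>?G\<^esub> h \<in> word_value R ` ?W m"
      unfolding gh word_value_append[symmetric] by blast
  qed
  moreover have "A \<subseteq> word_value R ` ?W m"
    using m unfolding B by (intro image_mono) fastforce
  ultimately have "generate ?G A \<subseteq> word_value R ` ?W m"
    by (rule G.generate_subgroup_incl[rotated])
  then show ?thesis using A(3) finite_subset by blast
qed

text \<open>For fixed \<open>N\<close> this is a finite conjunction of finite disjunctions of
  equations between values, so it can be certified by finitely many certificates. The condition
  \<open>0 < N\<close> puts the empty word, whose code is 0, among the representatives.\<close>

definition closed_code_bound :: "nat gword set \<Rightarrow> nat \<Rightarrow> nat \<Rightarrow> bool" where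
  "closed_code_bound S m N \<longleftrightarrow> 0 < N \<and> (\<forall>n<N. \<forall>a<2 * m. \<exists>n'<N.
    word_value S (word_decode n') = word_value S (sum_decode a # word_decode n))"

text \<open>Induction on the word: the empty word has code 0, and closure under left multiplication
  by one letter keeps the value among those of the first \<open>N\<close> codes.\<close>

lemma finite_if_closed_code_bound:
  assumes "closed_code_bound S m N"
  shows "finite (word_value S ` {w. \<forall>a\<in>set w. sum_encode a < 2 * m})"
proof -
  have "\<exists>n<N. word_value S w = word_value S (word_decode n)"
    if "\<forall>a\<in>set w. sum_encode a < 2 * m" for w
    using that
  proof (induction w)
    case Nil
    show ?case using assms by (intro exI[of _ 0]) (simp add: closed_code_bound_def word_decode_def)
  next
    case (Cons a w)
    then obtain n where n: "n < N" "word_value S w = word_value S (word_decode n)" by auto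
    with Cons.prems assms obtain n' where n': "n' < N"
      "word_value S (word_decode n') = word_value S (sum_decode (sum_encode a) # word_decode n)"
      unfolding closed_code_bound_def by (metis list.set_intros(1))
    have "word_value S (a # w) = word_value S (a # word_decode n)"
      using n(2) word_value_append[of S "[a]" w] word_value_append[of S "[a]" "word_decode n"]
      by (simp only: append_Cons append_Nil)
    with n' show ?case by (intro exI[of _ n']) simp
  qed
  then have "word_value S ` {w. \<forall>a\<in>set w. sum_encode a < 2 * m}
      \<subseteq> (\<lambda>n. word_value S (word_decode n)) ` {..<N}"
    by (fastforce simp: image_iff)
  then show ?thesis by (rule finite_subset) simp
qed

text \<open>Each of the finitely many values gets a representative, and \<open>N\<close> is taken
  above all their codes. Then every word, in particular every product to be tested, has a
  representative below \<open>N\<close>, which also forces \<open>N\<close> to be positive.\<close>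

lemma closed_code_bound_if_finite:
  assumes "finite (range (word_value S))"
  shows "\<exists>N. closed_code_bound S m N"
proof -
  obtain B where B: "finite B" "range (word_value S) = word_value S ` B"
    using finite_subset_image[OF assms subset_refl] by blast
  then obtain N where N: "\<And>w. w \<in> B \<Longrightarrow> word_code w < N"
    by (metis finite_imageI finite_nat_set_iff_bounded image_eqI)
  have "\<exists>n'<N. word_value S (word_decode n') = word_value S w" for w
  proof -
    obtain v where "v \<in> B" "word_value S w = word_value S v" using B(2) by (metis imageE rangeI)
    then show ?thesis using N by (intro exI[of _ "word_code v"]) simp
  qed
  then have "closed_code_bound S m N"
    unfolding closed_code_bound_def by (metis gr_zeroI not_less_zero)
  then show ?thesis by blast
qed

lemma word_value_nontrivial_iff:
  assumes "just_infinite (presented_group R)"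
    and m: "infinite (word_value R ` {w. \<forall>a\<in>set w. sum_encode a < 2 * m})"
  shows "word_value R x \<noteq> \<one>\<^bsub>presented_group R\<^esub> \<longleftrightarrow> (\<exists>N. closed_code_bound (insert x R) m N)"
proof
  assume "word_value R x \<noteq> \<one>\<^bsub>presented_group R\<^esub>"
  then show "\<exists>N. closed_code_bound (insert x R) m N"
    by (intro closed_code_bound_if_finite finite_word_values_insert assms)
next
  assume "\<exists>N. closed_code_bound (insert x R) m N"
  then have fin: "finite (word_value (insert x R) ` {w. \<forall>a\<in>set w. sum_encode a < 2 * m})"
    using finite_if_closed_code_bound by blast
  show "word_value R x \<noteq> \<one>\<^bsub>presented_group R\<^esub>"
  proof
    assume "word_value R x = \<one>\<^bsub>presented_group R\<^esub>"
    then have "word_value (insert x R) w = word_value R w" for w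
      by (simp add: word_value_def relator_subgroup_insert)
    with fin m show False by simp
  qed
qed

section \<open>The word problem\<close>

lemma decidable_word_problem_nonempty:
  assumes f: "recursive_function f" "word_code ` R = range f"
    and G: "just_infinite (presented_group R)" "\<not> locally_finite (presented_group R)"
  shows "decidable (word_code ` {w. word_value R w = \<one>\<^bsub>presented_group R\<^esub>})"
proof -
  obtain m where m: "infinite (word_value R ` {w. \<forall>a\<in>set w. sum_encode a < 2 * m})"
    using infinite_word_values_finite_alphabet[OF G(2)] by blast
  \<comment> \<open>Starting at 0, the empty word, a certificate builds the reduced form of
    \<open>x\<close> from relators alone; the extra relator is set to 0 and is thus the empty word,
    which adds nothing.\<close>
  define P where "P c x \<longleftrightarrow> run_certificate f 0 c 0 = free_reduce_code x" for c x
  \<comment> \<open>The witness \<open>t\<close> packs the bound \<open>N\<close> together with a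
    common bound for the codes of all certificates, so that every quantifier is bounded and
    \<open>Q\<close> is decidable. The number \<open>Suc (prod_encode (a, n))\<close> codes the word
    with first letter \<open>a\<close> followed by the word coded by \<open>n\<close>.\<close>
  define Q where "Q t x \<longleftrightarrow> 0 < fst (prod_decode t) \<and>
    (\<forall>n<fst (prod_decode t). \<forall>a<2 * m. \<exists>n'<fst (prod_decode t). \<exists>c<snd (prod_decode t).
      run_certificate f x c (free_reduce_code n') = free_reduce_code (Suc (prod_encode (a, n))))" for t x
  have decP: "decidable {z. P (fst (prod_decode z)) (snd (prod_decode z))}"
    unfolding P_def by (intro recursive_intros recursive_run_certificate f)
  have decQ: "decidable {z. Q (fst (prod_decode z)) (snd (prod_decode z))}"
    unfolding Q_def by (intro recursive_intros recursive_run_certificate f)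
  have exP: "(\<exists>c. P c x) \<longleftrightarrow> word_value R (word_decode x) = \<one>\<^bsub>presented_group R\<^esub>" for x
  proof -
    have "word_value R [] = \<one>\<^bsub>presented_group R\<^esub>" by (rule word_value_Nil)
    then have "word_value (insert [] R) w = word_value R w" for w
      by (simp add: word_value_def relator_subgroup_insert)
    then have "(\<exists>c. run_certificate f (word_code []) c (word_code (free_reduce []))
        = word_code (free_reduce (word_decode x))) \<longleftrightarrow> word_value R [] = word_value R (word_decode x)"
      using run_certificate_iff[OF f(2), of "[]" "[]" "word_decode x"] by simp
    moreover have "word_code (free_reduce []) = 0"
      by (simp add: free_reduce_def word_code_Nil)
    ultimately show ?thesis
      using free_reduce_code[of "word_decode x"]
      by (simp add: P_def word_code_Nil word_value_Nil eq_commute[of "\<one>\<^bsub>presented_group R\<^esub>"])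
  qed
  have exQ: "(\<exists>t. Q t x) \<longleftrightarrow> word_value R (word_decode x) \<noteq> \<one>\<^bsub>presented_group R\<^esub>" for x
  proof -
    let ?S = "insert (word_decode x) R"
    let ?E = "\<lambda>n' a n c. run_certificate f x c (free_reduce_code n') = free_reduce_code (Suc (prod_encode (a, n)))"
    have "(\<exists>c. ?E n' a n c)
        \<longleftrightarrow> word_value ?S (word_decode n') = word_value ?S (sum_decode a # word_decode n)" for n' a n
      using run_certificate_iff[OF f(2), of "word_decode x" "word_decode n'" "sum_decode a # word_decode n"]
      by (simp add: free_reduce_code[symmetric] word_code_Cons)
    then have bound: "closed_code_bound ?S m N \<longleftrightarrow>
        0 < N \<and> (\<forall>n<N. \<forall>a<2 * m. \<exists>n'<N. \<exists>c. ?E n' a n c)" for N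
      by (simp add: closed_code_bound_def)
    have "(\<exists>t. Q t x) \<longleftrightarrow> (\<exists>N. closed_code_bound ?S m N)"
    proof
      assume "\<exists>t. Q t x"
      then obtain t where "Q t x" ..
      then have "closed_code_bound ?S m (fst (prod_decode t))"
        unfolding bound Q_def by meson
      then show "\<exists>N. closed_code_bound ?S m N" ..
    next
      assume "\<exists>N. closed_code_bound ?S m N"
      then obtain N where "closed_code_bound ?S m N" ..
      then have N: "0 < N" "\<forall>n<N. \<forall>a<2 * m. \<exists>n' c. n' < N \<and> ?E n' a n c"
        unfolding bound by simp_all
      from N(2) obtain n' c
        where n'c: "\<And>n a. n < N \<Longrightarrow> a < 2 * m \<Longrightarrow> n' n a < N \<and> ?E (n' n a) a n (c n a)"
        by metis
      \<comment> \<open>Only finitely many pairs \<open>(n, a)\<close> have to be certified, hence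
        one number \<open>M\<close> bounds all the chosen certificates.\<close>
      have "finite ((\<lambda>(n, a). c n a) ` ({..<N} \<times> {..<2 * m}))" by simp
      then obtain M where "\<And>k. k \<in> (\<lambda>(n, a). c n a) ` ({..<N} \<times> {..<2 * m}) \<Longrightarrow> k < M"
        by (metis finite_nat_set_iff_bounded)
      then have "c n a < M" if "n < N" "a < 2 * m" for n a using that by force
      then have "\<exists>i<N. \<exists>d<M. ?E i a n d" if "n < N" "a < 2 * m" for n a
        using that n'c by blast
      then have "Q (prod_encode (N, M)) x" using N(1) by (simp add: Q_def)
      then show "\<exists>t. Q t x" by blast
    qed
    then show ?thesis using word_value_nontrivial_iff[OF G(1) m] by simp
  qed
  have mem: "x \<in> word_code ` {w. word_value R w = \<one>\<^bsub>presented_group R\<^esub>}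
      \<longleftrightarrow> word_value R (word_decode x) = \<one>\<^bsub>presented_group R\<^esub>" for x
    by (metis (mono_tags, lifting) image_iff mem_Collect_eq word_code_decode word_decode_code)
  show ?thesis
    by (rule decidable_of_searches[OF decP decQ]) (simp_all only: mem exP exQ)
qed

theorem theorem4:
  fixes R :: "nat gword set"
  assumes "recursively_enumerable (word_code ` R)"
    and "just_infinite (presented_group R)"
    and "\<not> locally_finite (presented_group R)"
  shows "decidable (word_code ` {w. word_value R w = \<one>\<^bsub>presented_group R\<^esub>})"
proof (cases "R = {}")
  case True
  txt \<open>An enumeration has a non-empty range, so the trivial relator is added.\<close>
  have "word_value R [] = \<one>\<^bsub>presented_group R\<^esub>" by (rule word_value_Nil)
  then have "relator_subgroup {[]} = relator_subgroup R"
    using relator_subgroup_insert True by metis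
  then have eq: "presented_group R = presented_group {[]}" "word_value R = word_value {[]}"
    by (simp_all add: presented_group_def word_value_def fun_eq_iff)
  have "word_code ` {[]} = range (\<lambda>n::nat. 0)" by (auto simp: word_code_Nil)
  from decidable_word_problem_nonempty[OF recursive_const this] show ?thesis
    using assms(2,3) unfolding eq by blast
next
  case False
  then obtain f where "recursive_function f" "word_code ` R = range f"
    using assms(1) unfolding recursively_enumerable_def by blast
  then show ?thesis by (rule decidable_word_problem_nonempty[OF _ _ assms(2,3)])
qed

end
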